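(* Let $p$ be an odd prime, $n,x\in\mathbb Z_p$ and $n(n+4x)\not\equiv 0\pmod p$. Then $$\left(\frac{n+4x}p\right)\sum_{k=0}^{p-1}\binom{2k}k\frac{W_k(x)}{(n+4x)^k}\equiv \left(\frac{-1}p\right)W_{\frac{p-1}2}\left(-\frac n4\right)\equiv\left(\frac np\right)\sum_{k=0}^{p-1}\frac{\binom{2k}k\binom{3k}k\binom{6k}{3k}}{n^{3k}}\pmod p.$$
   Context: For each nonnegative integer $m$, $W_m(x)=\sum_{k=0}^{[m/3]}\binom{2k}k\binom{3k}k\binom m{3k}x^{m-3k}$ (with $0^0=1$), where $[\cdot]$ is the greatest integer function. $\mathbb Z_p$ denotes the set of rational numbers whose denominator is not divisible by $p$; congruences modulo $p$ are taken in this ring. $\left(\frac ap\right)$ is the Legendre symbol, which for $a\in\mathbb Z_p$ means the Legendre symbol of any integer congruent to $a$ modulo $p$. *)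

theory Defs
  imports "HOL-Number_Theory.Number_Theory"
begin

definition W :: "nat \<Rightarrow> rat \<Rightarrow> rat" where
  "W m x = (\<Sum>k = 0..m div 3. of_nat (((2 * k) choose k) * ((3 * k) choose k) * (m choose (3 * k))) * x ^ (m - 3 * k))"

text \<open>
  \<open>quotient_of r\<close> is the representation of \<open>r\<close> in lowest terms with positive denominator,
  so \<open>Zp p\<close> is the localization of the integers at the prime \<open>p\<close>.
\<close>

definition Zp :: "nat \<Rightarrow> rat set" where
  "Zp p = {r. \<not> int p dvd snd (quotient_of r)}"

text \<open>
  Congruence modulo the ideal generated by \<open>p\<close>. It includes membership of both sides in \<open>Zp p\<close>.
\<close>

definition Zp_cong :: "nat \<Rightarrow> rat \<Rightarrow> rat \<Rightarrow> bool" where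
  "Zp_cong p a b \<longleftrightarrow> a \<in> Zp p \<and> b \<in> Zp p \<and> (\<exists>c \<in> Zp p. a - b = of_nat p * c)"

text \<open>
  The choice of the integer is immaterial, and one exists for every element of \<open>Zp p\<close>:
  see \<open>Zp_Legendre_eq\<close> and \<open>Zp_cong_int_exists\<close> below.
\<close>

definition Zp_Legendre :: "rat \<Rightarrow> nat \<Rightarrow> int" where
  "Zp_Legendre a p = Legendre (SOME m. Zp_cong p a (of_int m)) (int p)"

lemma Zp_iff:
  assumes "prime p"
  shows "r \<in> Zp p \<longleftrightarrow> (\<exists>a b. \<not> int p dvd b \<and> r = of_int a / of_int b)"
proof
  assume r: "r \<in> Zp p"
  obtain a b where q: "quotient_of r = (a, b)" by force
  then have "r = of_int a / of_int b" by (rule quotient_of_div)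
  with r q show "\<exists>a b. \<not> int p dvd b \<and> r = of_int a / of_int b"
    by (auto simp: Zp_def)
next
  assume "\<exists>a b. \<not> int p dvd b \<and> r = of_int a / of_int b"
  then obtain a b where b: "\<not> int p dvd b" and r: "r = of_int a / of_int b" by blast
  obtain c d where q: "quotient_of r = (c, d)" by force
  have d: "d > 0" using q by (rule quotient_of_denom_pos)
  have cop: "coprime c d" using q by (rule quotient_of_coprime)
  have b0: "b \<noteq> 0" using b by auto
  have "(of_int a :: rat) / of_int b = of_int c / of_int d"
    using quotient_of_div[OF q] r by simp
  then have "(of_int (a * d) :: rat) = of_int (c * b)"
    using b0 d by (simp add: field_simps)
  then have "a * d = c * b" using of_int_eq_iff by blast
  then have "d dvd c * b" by (metis dvd_triv_right)
  then have "d dvd b" using cop by (simp add: coprime_commute coprime_dvd_mult_right_iff)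
  then have "\<not> int p dvd d" using b dvd_trans by blast
  then show "r \<in> Zp p" by (simp add: Zp_def q)
qed

lemma of_int_in_Zp: "prime p \<Longrightarrow> of_int m \<in> Zp p"
  unfolding Zp_def by (auto simp: zdvd1_eq)

lemma Zp_cong_int_exists:
  assumes "prime p" "a \<in> Zp p"
  shows "\<exists>m. Zp_cong p a (of_int m)"
proof -
  obtain u v where v: "\<not> int p dvd v" and a: "a = of_int u / of_int v"
    using assms Zp_iff by blast
  have "coprime v (int p)"
    using assms(1) v by (metis coprime_commute prime_imp_coprime prime_nat_int_transfer)
  then obtain w where "[v * w = 1] (mod int p)" using cong_solve_coprime_int by blast
  then obtain k where k: "v * w = 1 + int p * k"
    by (metis cong_iff_lin cong_sym)
  have v0: "v \<noteq> 0" using v by auto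
  have "(of_int u :: rat) - of_int (u * w) * of_int v = of_int (u - u * (v * w))" by simp
  also have "\<dots> = of_nat p * of_int (- u * k)" unfolding k by (simp add: algebra_simps)
  finally have num: "(of_int u :: rat) - of_int (u * w) * of_int v = of_nat p * of_int (- u * k)" .
  have "a - of_int (u * w) = (of_int u - of_int (u * w) * of_int v) / of_int v"
    unfolding a using v0 by (simp add: diff_divide_distrib)
  then have "a - of_int (u * w) = of_nat p * (of_int (- u * k) / of_int v)"
    unfolding num by simp
  moreover have "of_int (- u * k) / of_int v \<in> Zp p"
    using assms(1) v Zp_iff by blast
  ultimately show ?thesis
    unfolding Zp_cong_def using assms of_int_in_Zp by blast
qed

lemma Zp_cong_of_int_iff:
  assumes "prime p"
  shows "Zp_cong p (of_int m) (of_int l) \<longleftrightarrow> [m = l] (mod int p)"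
proof
  assume "Zp_cong p (of_int m) (of_int l)"
  then obtain c where c: "c \<in> Zp p" "(of_int m :: rat) - of_int l = of_nat p * c"
    by (auto simp: Zp_cong_def)
  obtain u v where v: "\<not> int p dvd v" and cuv: "c = of_int u / of_int v"
    using c(1) assms Zp_iff by blast
  have v0: "v \<noteq> 0" using v by auto
  have "(of_int ((m - l) * v) :: rat) = of_int (int p * u)"
    using c(2) v0 unfolding cuv by (simp add: field_simps)
  then have "(m - l) * v = int p * u" using of_int_eq_iff by blast
  then have "int p dvd (m - l) * v" by simp
  then have "int p dvd m - l"
    using v assms by (simp add: prime_dvd_mult_iff)
  then show "[m = l] (mod int p)" by (simp add: cong_iff_dvd_diff)
next
  assume "[m = l] (mod int p)"
  then obtain k where "m - l = int p * k" by (auto simp: cong_iff_dvd_diff)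
  then have "(of_int m :: rat) - of_int l = of_nat p * of_int k"
    by (metis of_int_diff of_int_mult of_int_of_nat_eq)
  then show "Zp_cong p (of_int m) (of_int l)"
    unfolding Zp_cong_def using assms of_int_in_Zp by blast
qed

lemma Zp_add:
  assumes "prime p" "a \<in> Zp p" "b \<in> Zp p"
  shows "a + b \<in> Zp p"
proof -
  obtain u v u' v' where *: "\<not> int p dvd v" "a = of_int u / of_int v"
      "\<not> int p dvd v'" "b = of_int u' / of_int v'"
    using assms Zp_iff by meson
  then have "v \<noteq> 0" "v' \<noteq> 0" by auto
  then have "a + b = of_int (u * v' + u' * v) / of_int (v * v')"
    using * by (simp add: field_simps)
  moreover have "\<not> int p dvd v * v'"
    using * assms(1) by (simp add: prime_dvd_mult_iff)
  ultimately show ?thesis using assms(1) Zp_iff by blast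
qed

lemma Zp_uminus:
  assumes "prime p" "a \<in> Zp p"
  shows "- a \<in> Zp p"
proof -
  obtain u v where "\<not> int p dvd v" "a = of_int u / of_int v"
    using assms Zp_iff by meson
  then have "\<not> int p dvd v \<and> - a = of_int (- u) / of_int v" by simp
  then show ?thesis using assms(1) Zp_iff by blast
qed

lemma Legendre_cong:
  assumes "[a = b] (mod p)"
  shows "Legendre a p = Legendre b p"
proof -
  have "[a = c] (mod p) \<longleftrightarrow> [b = c] (mod p)" "[c = a] (mod p) \<longleftrightarrow> [c = b] (mod p)" for c
    using assms cong_trans cong_sym by blast+
  then show ?thesis by (simp add: Legendre_def QuadRes_def)
qed

lemma Zp_Legendre_eq:
  assumes "prime p" "Zp_cong p a (of_int m)"
  shows "Zp_Legendre a p = Legendre m (int p)"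
proof -
  define l where "l = (SOME m. Zp_cong p a (of_int m))"
  have l: "Zp_cong p a (of_int l)"
    unfolding l_def using assms(2) by (rule someI)
  obtain c d where c: "c \<in> Zp p" "a - of_int m = of_nat p * c"
    and d: "d \<in> Zp p" "a - of_int l = of_nat p * d"
    using l assms(2) by (auto simp: Zp_cong_def)
  have "(of_int l :: rat) - of_int m = of_nat p * (c + - d)"
    using c(2) d(2) by (simp add: algebra_simps)
  moreover have "c + - d \<in> Zp p" using assms(1) c(1) d(1) Zp_add Zp_uminus by blast
  ultimately have "Zp_cong p (of_int l) (of_int m)"
    unfolding Zp_cong_def using assms(1) of_int_in_Zp by blast
  then have "[l = m] (mod int p)" using assms(1) Zp_cong_of_int_iff by blast
  then show ?thesis unfolding Zp_Legendre_def l_def[symmetric] by (rule Legendre_cong)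
qed

end

theory Submission
  imports Defs
begin

text \<open>
  Put \<open>h = (p - 1) / 2\<close>. Modulo \<open>p\<close>, with \<open>C\<close> denoting binomial coefficients, one has \<open>C(2k, k) = C(h, k) (-4)^k\<close> for \<open>k < p\<close>, and
  Euler's criterion turns the Legendre symbols of \<open>n + 4x\<close> and \<open>n\<close> into \<open>h\<close>-th powers.
  Since \<open>W\<close> is an Appell sequence, \<open>\<Sum>k. C(h, k) y^(h - k) W_k(x) = W_h(x + y)\<close>, and with
  \<open>y = -(n + 4x)/4\<close> the first sum collapses to \<open>(-4)^h W_h(-n/4)\<close>. The last sum, after the same
  replacement of \<open>C(6k, 3k)\<close>, is the defining expansion of \<open>(-4)^h W_h(-n/4)\<close>; its
  terms with \<open>3k \<ge> p\<close> vanish because \<open>C(2k, k) C(3k, k) = (3k)! / k!^3\<close>.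
\<close>

section \<open>Arithmetic in the ring of p-integral rationals and its congruences\<close>

lemma Zp_mult:
  assumes "prime p" "a \<in> Zp p" "b \<in> Zp p"
  shows "a * b \<in> Zp p"
proof -
  obtain u v u' v' where *: "\<not> int p dvd v" "a = of_int u / of_int v"
      "\<not> int p dvd v'" "b = of_int u' / of_int v'"
    using assms Zp_iff by meson
  then have "a * b = of_int (u * u') / of_int (v * v')" by simp
  moreover have "\<not> int p dvd v * v'"
    using * assms(1) by (simp add: prime_dvd_mult_iff)
  ultimately show ?thesis using assms(1) Zp_iff by blast
qed

lemma of_nat_in_Zp: "prime p \<Longrightarrow> of_nat m \<in> Zp p"
  using of_int_in_Zp[of p "int m"] by simp

lemma Zp_power:
  assumes "prime p" "a \<in> Zp p"
  shows "a ^ k \<in> Zp p"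
proof (induction k)
  case 0
  show ?case using of_nat_in_Zp[of p 1] assms(1) by simp
next
  case (Suc k)
  then show ?case using assms Zp_mult by simp
qed

lemma Zp_sum:
  assumes "prime p" "\<And>i. i \<in> A \<Longrightarrow> f i \<in> Zp p"
  shows "sum f A \<in> Zp p"
  using assms(2)
proof (induction A rule: infinite_finite_induct)
  case (insert i A)
  then show ?case using assms(1) Zp_add by simp
qed (use of_nat_in_Zp[OF assms(1), of 0] in auto)

text \<open>If \<open>p\<close> divided the numerator of a fraction representing \<open>a\<close>,
  then \<open>a\<close> would be congruent to 0; so the flipped fraction has an admissible
  denominator.\<close>

lemma Zp_inverse:
  assumes "prime p" "a \<in> Zp p" "\<not> Zp_cong p a 0"
  shows "inverse a \<in> Zp p"
proof -
  obtain u v where uv: "\<not> int p dvd v" "a = of_int u / of_int v"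
    using assms Zp_iff by meson
  have "\<not> int p dvd u"
  proof
    assume "int p dvd u"
    then obtain k where "u = int p * k" by blast
    then have "a - 0 = of_nat p * (of_int k / of_int v)" using uv by simp
    moreover have "of_int k / of_int v \<in> Zp p" using uv assms(1) Zp_iff by blast
    moreover have "0 \<in> Zp p" using assms(1) of_int_in_Zp[of p 0] by simp
    ultimately have "Zp_cong p a 0"
      unfolding Zp_cong_def using assms(2) by blast
    with assms(3) show False by blast
  qed
  moreover have "inverse a = of_int v / of_int u" using uv by simp
  ultimately show ?thesis using assms(1) Zp_iff by blast
qed

lemma Zp_cong_refl: "prime p \<Longrightarrow> a \<in> Zp p \<Longrightarrow> Zp_cong p a a"
  using of_int_in_Zp[of p 0] unfolding Zp_cong_def by force

lemma Zp_cong_sym: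
  assumes "prime p" "Zp_cong p a b"
  shows "Zp_cong p b a"
proof -
  obtain c where c: "c \<in> Zp p" "a - b = of_nat p * c"
    using assms by (auto simp: Zp_cong_def)
  then have "b - a = of_nat p * - c" by (simp add: algebra_simps)
  then show ?thesis using assms c Zp_uminus unfolding Zp_cong_def by blast
qed

lemma Zp_cong_add:
  assumes "prime p" "Zp_cong p a b" "Zp_cong p a' b'"
  shows "Zp_cong p (a + a') (b + b')"
proof -
  obtain c c' where c: "c \<in> Zp p" "a - b = of_nat p * c" "c' \<in> Zp p" "a' - b' = of_nat p * c'"
    using assms by (auto simp: Zp_cong_def)
  then have "a + a' - (b + b') = of_nat p * (c + c')" by (simp add: algebra_simps)
  then show ?thesis using assms c Zp_add unfolding Zp_cong_def by blast
qed

lemma Zp_cong_trans: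
  assumes "prime p" "Zp_cong p a b" "Zp_cong p b d"
  shows "Zp_cong p a d"
proof -
  obtain c c' where c: "c \<in> Zp p" "a - b = of_nat p * c" "c' \<in> Zp p" "b - d = of_nat p * c'"
    using assms by (auto simp: Zp_cong_def)
  then have "a - d = of_nat p * (c + c')" by (simp add: algebra_simps)
  then show ?thesis using assms c Zp_add unfolding Zp_cong_def by blast
qed

lemma Zp_cong_mult:
  assumes "prime p" "Zp_cong p a b" "Zp_cong p a' b'"
  shows "Zp_cong p (a * a') (b * b')"
proof -
  obtain c c' where c: "c \<in> Zp p" "a - b = of_nat p * c" "c' \<in> Zp p" "a' - b' = of_nat p * c'"
    using assms by (auto simp: Zp_cong_def)
  have "a * a' - b * b' = (a - b) * a' + b * (a' - b')" by (simp add: algebra_simps)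
  also have "\<dots> = of_nat p * (c * a' + b * c')" unfolding c by (simp add: algebra_simps)
  finally have "a * a' - b * b' = of_nat p * (c * a' + b * c')" .
  moreover have "c * a' + b * c' \<in> Zp p"
    using assms c by (auto simp: Zp_cong_def intro!: Zp_add Zp_mult)
  ultimately show ?thesis using assms Zp_mult unfolding Zp_cong_def by blast
qed

lemma Zp_cong_power:
  assumes "prime p" "Zp_cong p a b"
  shows "Zp_cong p (a ^ k) (b ^ k)"
proof (induction k)
  case 0
  show ?case using Zp_cong_refl[of p 1] of_nat_in_Zp[of p 1] assms(1) by simp
next
  case (Suc k)
  then show ?case using assms Zp_cong_mult by simp
qed

lemma Zp_cong_sum:
  assumes "prime p" "\<And>i. i \<in> A \<Longrightarrow> Zp_cong p (f i) (g i)"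
  shows "Zp_cong p (sum f A) (sum g A)"
  using assms(2)
proof (induction A rule: infinite_finite_induct)
  case (insert i A)
  then show ?case using assms(1) Zp_cong_add by simp
qed (use Zp_cong_refl[of p 0] of_nat_in_Zp[OF assms(1), of 0] assms(1) in auto)

text \<open>Euler's criterion holds for an integer congruent to \<open>a\<close>, and powers respect
  the congruence. The symbol thus becomes a power that can be multiplied into a sum.\<close>

lemma Zp_Legendre_cong_power:
  assumes "prime p" "odd p" "a \<in> Zp p"
  shows "Zp_cong p (of_int (Zp_Legendre a p)) (a ^ ((p - 1) div 2))"
proof -
  obtain m where m: "Zp_cong p a (of_int m)" using assms Zp_cong_int_exists by blast
  have "p > 2" using assms prime_ge_2_nat[of p] by (cases "p = 2") auto
  then have "[Legendre m (int p) = m ^ ((p - 1) div 2)] (mod int p)"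
    using assms euler_criterion by simp
  then have "Zp_cong p (of_int (Zp_Legendre a p)) (of_int m ^ ((p - 1) div 2))"
    using assms(1) m Zp_Legendre_eq Zp_cong_of_int_iff by (metis of_int_power)
  then show ?thesis
    using assms(1) m Zp_cong_power Zp_cong_sym Zp_cong_trans by blast
qed

section \<open>Binomial coefficients modulo p\<close>

lemma central_binomial_Suc: "Suc k * (2 * Suc k choose Suc k) = 2 * (2 * k + 1) * (2 * k choose k)"
proof -
  have "Suc k * (2 * Suc k choose Suc k) = 2 * Suc k * (Suc (2 * k) choose k)"
    using Suc_times_binomial[of k "Suc (2 * k)"] by simp
  moreover have "Suc (2 * k) choose k = Suc (2 * k) choose Suc k"
    using binomial_symmetric[of k "Suc (2 * k)"] by simp
  moreover have "Suc k * (Suc (2 * k) choose Suc k) = Suc (2 * k) * (2 * k choose k)"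
    by (rule Suc_times_binomial)
  ultimately show ?thesis by (simp add: mult.assoc del: binomial_Suc_Suc)
qed

text \<open>Both sides equal 1 at k = 0 and satisfy the same first-order recurrence modulo p:
  multiplying the next term by k + 1 gives the factor 2(2k + 1) on the left and -4(h - k) = 2(2k +
  1) - 2p on the right, since p = 2h + 1. As k + 1 < p, the factor k + 1 cancels.\<close>

lemma central_binomial_cong:
  assumes "prime p" "odd p" "k < p"
  shows "[int (2 * k choose k) = int ((p - 1) div 2 choose k) * (- 4) ^ k] (mod int p)"
  using assms(3)
proof (induction k)
  case 0
  show ?case by simp
next
  case (Suc k)
  define h where "h = (p - 1) div 2"
  have p: "int p = 2 * int h + 1" using assms(2) unfolding h_def by (auto elim: oddE)
  \<comment> \<open>The range of k extends past h, so the difference is taken in the integers; for k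
    > h both binomial coefficients are 0.\<close>
  have step: "int (Suc k) * int (h choose Suc k) = (int h - int k) * int (h choose k)"
  proof (cases "k \<le> h")
    case True
    have "Suc k * (h choose Suc k) = (h - k) * (h choose k)"
      by (simp only: binomial_absorption binomial_absorb_comp)
    then show ?thesis using True by (metis of_nat_diff of_nat_mult)
  qed (simp add: binomial_eq_0)
  have "int (Suc k) * (int (h choose Suc k) * (- 4) ^ Suc k)
      = (int (Suc k) * int (h choose Suc k)) * (- 4) ^ Suc k" by (simp only: mult.assoc)
  also have "\<dots> = (2 * (2 * int k + 1) - 2 * int p) * (int (h choose k) * (- 4) ^ k)"
    unfolding step p by (simp add: algebra_simps)
  finally have b: "int (Suc k) * (int (h choose Suc k) * (- 4) ^ Suc k)
      = (2 * (2 * int k + 1) - 2 * int p) * (int (h choose k) * (- 4) ^ k)" .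
  have a: "int (Suc k) * int (2 * Suc k choose Suc k) = 2 * (2 * int k + 1) * int (2 * k choose k)"
    using arg_cong[OF central_binomial_Suc[of k], of int]
    by (simp only: of_nat_mult of_nat_add of_nat_numeral of_nat_1)
  have "[2 * (2 * int k + 1) = 2 * (2 * int k + 1) - 2 * int p] (mod int p)"
    by (simp add: cong_iff_dvd_diff)
  then have "[int (Suc k) * int (2 * Suc k choose Suc k)
      = int (Suc k) * (int (h choose Suc k) * (- 4) ^ Suc k)] (mod int p)"
    unfolding a b using Suc by (intro cong_mult) (auto simp: h_def)
  moreover have "coprime (int (Suc k)) (int p)"
    using assms(1) Suc.prems
    by (metis coprime_commute coprime_int_iff nat_dvd_not_less prime_imp_coprime zero_less_Suc)
  ultimately show ?case unfolding h_def by (metis cong_mult_lcancel)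
qed

text \<open>The product is (3k)! / k!^3, where p divides the numerator since p \<le> 3k but not the
  denominator since k < p.\<close>

lemma prime_dvd_trinomial:
  assumes "prime p" "k < p" "p \<le> 3 * k"
  shows "p dvd (2 * k choose k) * (3 * k choose k)"
proof -
  have "fact k * fact (2 * k) * (3 * k choose k) = (fact (3 * k) :: nat)"
    using binomial_fact_lemma[of k "3 * k"] by simp
  moreover have "fact k * fact k * (2 * k choose k) = (fact (2 * k) :: nat)"
    using binomial_fact_lemma[of k "2 * k"] by simp
  ultimately have "fact k * fact k * fact k * ((2 * k choose k) * (3 * k choose k)) = (fact (3 * k) :: nat)"
    by (metis mult.assoc mult.commute)
  moreover have "p dvd fact (3 * k)" "\<not> p dvd fact k"
    using assms by (auto simp: prime_dvd_fact_iff)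
  ultimately show ?thesis using assms(1) by (metis prime_dvd_mult_iff)
qed

section \<open>The polynomials W and closed forms of the two sums\<close>

lemma W_eq_sum_upto:
  assumes "m \<le> 3 * N + 2"
  shows "W m x = (\<Sum>k = 0..N. of_nat (((2 * k) choose k) * ((3 * k) choose k) * (m choose (3 * k))) * x ^ (m - 3 * k))"
  unfolding W_def
proof (rule sum.mono_neutral_left)
  \<comment> \<open>Here 3k > m, so \<open>m choose (3 * k)\<close> is 0 and the truncated exponent
    does no harm.\<close>
  show "\<forall>k\<in>{0..N} - {0..m div 3}. of_nat (((2 * k) choose k) * ((3 * k) choose k) * (m choose (3 * k))) * x ^ (m - 3 * k) = 0"
    by (auto simp: binomial_eq_0)
qed (use assms in auto)

lemma W_in_Zp: "prime p \<Longrightarrow> x \<in> Zp p \<Longrightarrow> W m x \<in> Zp p"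
  unfolding W_def by (intro Zp_sum Zp_mult of_nat_in_Zp Zp_power)

text \<open>The Appell property of the monomials C(k, i) x^(k - i): the identity C(h, k) C(k, i) =
  C(h, i) C(h - i, k - i) takes C(h, i) out of the sum and leaves a binomial expansion.\<close>

lemma binomial_shift:
  fixes x y :: "'a :: comm_semiring_1"
  shows "(\<Sum>k = 0..h. of_nat ((h choose k) * (k choose i)) * y ^ (h - k) * x ^ (k - i))
    = of_nat (h choose i) * (x + y) ^ (h - i)"
proof (cases "i \<le> h")
  case True
  have "(\<Sum>k = 0..h. of_nat ((h choose k) * (k choose i)) * y ^ (h - k) * x ^ (k - i))
      = (\<Sum>k = i..h. of_nat ((h choose k) * (k choose i)) * y ^ (h - k) * x ^ (k - i))"
    by (rule sum.mono_neutral_right) (auto simp: binomial_eq_0)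
  also have "\<dots> = (\<Sum>k = i..h. of_nat (h choose i) * (of_nat (h - i choose (k - i)) * x ^ (k - i) * y ^ (h - k)))"
  proof (rule sum.cong)
    fix k assume "k \<in> {i..h}"
    then have "(h choose k) * (k choose i) = (h choose i) * (h - i choose (k - i))"
      by (intro choose_mult) auto
    then show "of_nat ((h choose k) * (k choose i)) * y ^ (h - k) * x ^ (k - i)
        = of_nat (h choose i) * (of_nat (h - i choose (k - i)) * x ^ (k - i) * y ^ (h - k))"
      by (simp add: mult_ac)
  qed simp
  also have "\<dots> = of_nat (h choose i) * (\<Sum>k = i..h. of_nat (h - i choose (k - i)) * x ^ (k - i) * y ^ (h - k))"
    by (simp add: sum_distrib_left)
  also have "(\<Sum>k = i..h. of_nat (h - i choose (k - i)) * x ^ (k - i) * y ^ (h - k))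
      = (\<Sum>k\<le>h - i. of_nat (h - i choose k) * x ^ k * y ^ (h - i - k))"
    by (rule sum.reindex_bij_witness[of _ "\<lambda>k. k + i" "\<lambda>k. k - i"]) (use True in auto)
  also have "\<dots> = (x + y) ^ (h - i)" by (rule binomial_ring[symmetric])
  finally show ?thesis .
qed (auto simp: binomial_eq_0 intro!: sum.neutral)

text \<open>W_k combines the monomials C(k, 3j) x^(k - 3j) with coefficients independent of k, so
  \<open>binomial_shift\<close> applies to each j separately.\<close>

lemma W_Appell: "(\<Sum>k = 0..h. of_nat (h choose k) * y ^ (h - k) * W k x) = W h (x + y)"
proof -
  define a where "a j = (of_nat (((2 * j) choose j) * ((3 * j) choose j)) :: rat)" for j
  \<comment> \<open>One cutoff \<open>h\<close> for all k \<le> h makes the range of j independent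
    of k, so the two summations can be exchanged.\<close>
  have W: "W k z = (\<Sum>j = 0..h. a j * (of_nat (k choose (3 * j)) * z ^ (k - 3 * j)))" if "k \<le> h" for k z
    using that by (subst W_eq_sum_upto[of k h]) (auto simp: a_def mult_ac)
  have "(\<Sum>k = 0..h. of_nat (h choose k) * y ^ (h - k) * W k x)
      = (\<Sum>k = 0..h. \<Sum>j = 0..h. a j * (of_nat ((h choose k) * (k choose (3 * j))) * y ^ (h - k) * x ^ (k - 3 * j)))"
    by (rule sum.cong) (auto simp: W sum_distrib_left mult_ac)
  also have "\<dots> = (\<Sum>j = 0..h. a j * (\<Sum>k = 0..h. of_nat ((h choose k) * (k choose (3 * j))) * y ^ (h - k) * x ^ (k - 3 * j)))"
    by (subst sum.swap) (simp add: sum_distrib_left)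
  also have "\<dots> = W h (x + y)" by (simp only: binomial_shift W[OF order_refl])
  finally show ?thesis .
qed

text \<open>Since m^h (-4)^k / m^k = (-4)^h (-m/4)^(h - k), this is \<open>W_Appell\<close> with y =
  -m/4; terms with k > h vanish.\<close>

lemma power_mult_binomial_sum:
  fixes m x :: rat
  assumes "m \<noteq> 0" "h \<le> N"
  shows "m ^ h * (\<Sum>k = 0..N. of_nat (h choose k) * (- 4) ^ k * (W k x / m ^ k))
    = (- 4) ^ h * W h (x - m / 4)"
proof -
  have "m ^ h * (\<Sum>k = 0..N. of_nat (h choose k) * (- 4) ^ k * (W k x / m ^ k))
      = m ^ h * (\<Sum>k = 0..h. of_nat (h choose k) * (- 4) ^ k * (W k x / m ^ k))"
    using assms(2) by (intro arg_cong[of _ _ "(*) _"] sum.mono_neutral_right) (auto simp: binomial_eq_0)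
  also have "\<dots> = (\<Sum>k = 0..h. (- 4) ^ h * (of_nat (h choose k) * (- (m / 4)) ^ (h - k) * W k x))"
    unfolding sum_distrib_left
  proof (rule sum.cong)
    fix k assume "k \<in> {0..h}"
    \<comment> \<open>Naming the difference \<open>d\<close> removes the truncated subtraction from
      the exponent.\<close>
    then obtain d where h: "h = k + d" by (auto simp: le_iff_add)
    have "(- 4) ^ d * (- (m / 4)) ^ d = m ^ d" by (simp flip: power_mult_distrib)
    then show "m ^ h * (of_nat (h choose k) * (- 4) ^ k * (W k x / m ^ k))
        = (- 4) ^ h * (of_nat (h choose k) * (- (m / 4)) ^ (h - k) * W k x)"
      using assms(1) unfolding h by (simp add: power_add flip: \<open>_ = m ^ d\<close>)
  qed simp
  also have "\<dots> = (- 4) ^ h * W h (x - m / 4)"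
    using W_Appell[of h "- (m / 4)" x] by (simp flip: sum_distrib_left)
  finally show ?thesis .
qed

text \<open>The sums agree term by term, because n^(h - 3k) (-4)^(3k) = (-4)^h (-n/4)^(h - 3k) for
  3k \<le> h and both terms are 0 otherwise.\<close>

lemma power_mult_trinomial_sum:
  fixes n :: rat
  assumes "n \<noteq> 0" "h \<le> N"
  shows "n ^ h * (\<Sum>k = 0..N. of_nat (((2 * k) choose k) * ((3 * k) choose k)) * (of_nat (h choose (3 * k)) * (- 4) ^ (3 * k)) / n ^ (3 * k))
    = (- 4) ^ h * W h (- n / 4)"
proof -
  have "W h (- n / 4) = (\<Sum>k = 0..N. of_nat (((2 * k) choose k) * ((3 * k) choose k) * (h choose (3 * k))) * (- n / 4) ^ (h - 3 * k))"
    using assms(2) by (intro W_eq_sum_upto) simp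
  moreover have "n ^ h * (of_nat (((2 * k) choose k) * ((3 * k) choose k)) * (of_nat (h choose (3 * k)) * (- 4) ^ (3 * k)) / n ^ (3 * k))
      = (- 4) ^ h * (of_nat (((2 * k) choose k) * ((3 * k) choose k) * (h choose (3 * k))) * (- n / 4) ^ (h - 3 * k))" for k
  proof (cases "3 * k \<le> h")
    case True
    then obtain d where h: "h = 3 * k + d" by (auto simp: le_iff_add)
    have "(- 4) ^ d * (- (n / 4)) ^ d = n ^ d" by (simp flip: power_mult_distrib)
    then show ?thesis
      using assms(1) unfolding h by (simp add: power_add flip: \<open>_ = n ^ d\<close>)
  qed (simp add: binomial_eq_0)
  ultimately show ?thesis by (simp add: sum_distrib_left)
qed

text \<open>With h = (p - 1)/2, (-4)^h = (-1)^h 2^(p - 1): Euler's criterion handles the first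
  factor, Fermat's theorem the second.\<close>

lemma minus_four_power_cong:
  assumes "prime p" "odd p"
  shows "[(- 4) ^ ((p - 1) div 2) = Legendre (- 1) (int p)] (mod int p)"
proof -
  define h where "h = (p - 1) div 2"
  have p2: "p > 2" using assms prime_ge_2_nat[of p] by (cases "p = 2") auto
  have "[2 ^ (p - 1) = 1] (mod p)"
    using assms p2 by (intro fermat_theorem) (auto dest: dvd_imp_le)
  then have "[(2 :: int) ^ (p - 1) = 1] (mod int p)"
    by (metis cong_int_iff of_nat_1 of_nat_numeral of_nat_power)
  moreover have "p - 1 = 2 * h" using assms(2) unfolding h_def by (auto elim: oddE)
  ultimately have "[(4 :: int) ^ h = 1] (mod int p)" by (simp add: power_mult)
  moreover have "[(- 1) ^ h = Legendre (- 1) (int p)] (mod int p)"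
    using euler_criterion[of p "- 1"] assms(1) p2 cong_sym unfolding h_def by auto
  ultimately have "[(- 1) ^ h * 4 ^ h = Legendre (- 1) (int p) * 1] (mod int p)"
    by (intro cong_mult)
  then show ?thesis unfolding h_def by (simp flip: power_mult_distrib)
qed

section \<open>Assembly of the two congruences\<close>

theorem lemma2p4:
  fixes p :: nat and n x :: rat
  assumes "prime p" and "odd p"
    and "n \<in> Zp p" and "x \<in> Zp p"
    and "\<not> Zp_cong p (n * (n + 4 * x)) 0"
  shows "Zp_cong p
           (of_int (Zp_Legendre (n + 4 * x) p) *
             (\<Sum>k = 0..p - 1. of_nat ((2 * k) choose k) * (W k x / (n + 4 * x) ^ k)))
           (of_int (Legendre (- 1) (int p)) * W ((p - 1) div 2) (- n / 4))
         \<and> Zp_cong p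
           (of_int (Legendre (- 1) (int p)) * W ((p - 1) div 2) (- n / 4))
           (of_int (Zp_Legendre n p) *
             (\<Sum>k = 0..p - 1. of_nat (((2 * k) choose k) * ((3 * k) choose k) * ((6 * k) choose (3 * k))) / n ^ (3 * k)))"
proof -
  note p = assms(1)
  define h where "h = (p - 1) div 2"
  define m where "m = n + 4 * x"
  have hp: "h \<le> p - 1" unfolding h_def by simp
  have fourth: "n / 4 \<in> Zp p"
  proof -
    have "\<not> int p dvd 4"
    proof
      assume "int p dvd 4"
      then have "p dvd 2 ^ 2" using int_dvd_int_iff[of p "2 ^ 2"] by simp
      then show False
        using p assms(2) by (metis even_numeral dvd_refl prime_dvd_power primes_dvd_imp_eq two_is_prime_nat)
    qed
    then have "of_int 1 / of_int 4 \<in> Zp p" using p Zp_iff by blast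
    then show ?thesis using Zp_mult[OF p assms(3)] by fastforce
  qed
  have mZ: "m \<in> Zp p"
    unfolding m_def using p assms(3,4) Zp_add Zp_mult of_nat_in_Zp[OF p, of 4] by simp
  have nmZ: "n * m \<in> Zp p" using p assms(3) mZ Zp_mult by blast
  have inv: "inverse (n * m) \<in> Zp p"
    using Zp_inverse[OF p nmZ] assms(5) unfolding m_def by blast
  have "n * m \<noteq> 0"
    using assms(5) Zp_cong_refl[OF p, of 0] of_nat_in_Zp[OF p, of 0] unfolding m_def by force
  then have n0: "n \<noteq> 0" and m0: "m \<noteq> 0" by auto
  \<comment> \<open>Both inverses come from that of the product: 1/n = m/(nm) and 1/m =
    n/(nm).\<close>
  have invn: "inverse n \<in> Zp p"
    using Zp_mult[OF p mZ inv] m0 by (simp add: field_simps)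
  have invm: "inverse m \<in> Zp p"
    using Zp_mult[OF p assms(3) inv] n0 by (simp add: field_simps)
  have invnk: "inverse n ^ k \<in> Zp p" and invmk: "inverse m ^ k \<in> Zp p" for k
    using p invn invm Zp_power by auto
  have central: "Zp_cong p (of_nat (2 * k choose k)) (of_nat (h choose k) * (- 4) ^ k)" if "k < p" for k
    using Zp_cong_of_int_iff[OF p, THEN iffD2, OF central_binomial_cong[OF p assms(2) that]]
    unfolding h_def by simp
  let ?M = "of_int (Legendre (- 1) (int p)) * W h (- n / 4)"
  have WZ: "W h (- n / 4) \<in> Zp p"
    using W_in_Zp[OF p, of "- n / 4"] Zp_uminus[OF p fourth] by simp
  \<comment> \<open>Each outer expression will be compared with
    \<open>(- 4) ^ h * W h (- n / 4)\<close>; this congruence links that common value to the middle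
    one.\<close>
  have "Zp_cong p ((- 4) ^ h) (of_int (Legendre (- 1) (int p)))"
    using Zp_cong_of_int_iff[OF p, THEN iffD2, OF minus_four_power_cong[OF p assms(2)]]
    unfolding h_def by simp
  then have mid: "Zp_cong p ((- 4) ^ h * W h (- n / 4)) ?M"
    using Zp_cong_mult[OF p] Zp_cong_refl[OF p WZ] by blast
  have "Zp_cong p
      (of_int (Zp_Legendre m p) * (\<Sum>k = 0..p - 1. of_nat (2 * k choose k) * (W k x / m ^ k)))
      (m ^ h * (\<Sum>k = 0..p - 1. of_nat (h choose k) * (- 4) ^ k * (W k x / m ^ k)))"
  proof (intro Zp_cong_mult[OF p] Zp_cong_sum[OF p] Zp_cong_refl[OF p] central)
    show "Zp_cong p (of_int (Zp_Legendre m p)) (m ^ h)"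
      unfolding h_def by (rule Zp_Legendre_cong_power[OF p assms(2) mZ])
    show "W k x / m ^ k \<in> Zp p" for k
      using Zp_mult[OF p W_in_Zp[OF p assms(4)] invmk] by (simp add: divide_inverse power_inverse)
  qed (use p in \<open>auto dest: prime_gt_0_nat\<close>)
  \<comment> \<open>The choice m = n + 4x makes x cancel from the shifted argument.\<close>
  moreover have "x - m / 4 = - n / 4" by (simp add: m_def field_simps)
  ultimately have first: "Zp_cong p
      (of_int (Zp_Legendre m p) * (\<Sum>k = 0..p - 1. of_nat (2 * k choose k) * (W k x / m ^ k)))
      ((- 4) ^ h * W h (- n / 4))"
    using power_mult_binomial_sum[OF m0 hp, of x] by simp
  have "Zp_cong p
      (of_int (Zp_Legendre n p) *
        (\<Sum>k = 0..p - 1. of_nat (((2 * k) choose k) * ((3 * k) choose k) * ((6 * k) choose (3 * k))) / n ^ (3 * k)))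
      (n ^ h * (\<Sum>k = 0..p - 1. of_nat (((2 * k) choose k) * ((3 * k) choose k)) * (of_nat (h choose (3 * k)) * (- 4) ^ (3 * k)) / n ^ (3 * k)))"
  proof (intro Zp_cong_mult[OF p] Zp_cong_sum[OF p])
    show "Zp_cong p (of_int (Zp_Legendre n p)) (n ^ h)"
      unfolding h_def by (rule Zp_Legendre_cong_power[OF p assms(2,3)])
    fix k assume "k \<in> {0..p - 1}"
    then have k: "k < p" using p prime_gt_0_nat[of p] by auto
    let ?a = "((2 * k) choose k) * ((3 * k) choose k)"
    have "Zp_cong p (of_nat (?a * (6 * k choose (3 * k)))) (of_nat ?a * (of_nat (h choose (3 * k)) * (- 4) ^ (3 * k)))"
    \<comment> \<open>Below p, \<open>central\<close> applies at index 3k, as 6k = 2(3k). Otherwise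
      both sides are 0 modulo p: the left by \<open>prime_dvd_trinomial\<close>, the right because
      3k > h.\<close>
    proof (cases "3 * k < p")
      case True
      then show ?thesis
        using Zp_cong_mult[OF p Zp_cong_refl[OF p of_nat_in_Zp[OF p, of ?a]] central[OF True]] by simp
    next
      case False
      then have "int p dvd int (?a * (6 * k choose (3 * k)))"
        using prime_dvd_trinomial[OF p k] by (metis dvd_mult2 int_dvd_int_iff not_less)
      then have "Zp_cong p (of_int (int (?a * (6 * k choose (3 * k))))) (of_int 0)"
        using Zp_cong_of_int_iff[OF p] by (simp only: cong_0_iff)
      moreover have "h choose (3 * k) = 0" using False hp p prime_gt_0_nat[of p] by (intro binomial_eq_0) linarith
      ultimately show ?thesis by (simp only: of_int_of_nat_eq) simp
    qed
    from Zp_cong_mult[OF p this Zp_cong_refl[OF p invnk[of "3 * k"]]]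
    show "Zp_cong p (of_nat (?a * (6 * k choose (3 * k))) / n ^ (3 * k))
        (of_nat ?a * (of_nat (h choose (3 * k)) * (- 4) ^ (3 * k)) / n ^ (3 * k))"
      by (simp only: divide_inverse power_inverse)
  qed
  then have third: "Zp_cong p
      (of_int (Zp_Legendre n p) *
        (\<Sum>k = 0..p - 1. of_nat (((2 * k) choose k) * ((3 * k) choose k) * ((6 * k) choose (3 * k))) / n ^ (3 * k)))
      ((- 4) ^ h * W h (- n / 4))"
    unfolding power_mult_trinomial_sum[OF n0 hp] .
  show ?thesis
    using Zp_cong_trans[OF p first mid] Zp_cong_sym[OF p Zp_cong_trans[OF p third mid]]
    unfolding h_def m_def by blast
qed

end
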